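(* Let $f:\mathbb{R}^n\to\mathbb{R}$ be $C^2$ with $L$-Lipschitz gradient. Assume $\theta>0$ is chosen small enough such that, for every critical point $x^*$ of $f$ that satisfies $x^*\in\Lambda^+$, we also have $\Theta(x^* )\subset\Lambda^+$. Let $x^*\in\Lambda^+$ be a critical point of $f$, and let $l\in\mathbb{R}^n$. If $\|l\|_2<\theta$, then $f_l(x)=f(x)+l^Tx$ has exactly one critical point $x^*_l$ in $\Theta(x^* )$, and $x^*_l$ is a non-degenerate minimum of $f_l$. Additionally, if $f$ is $\alpha$-strongly convex on $\Theta(x^* )$, then $$f(x^*_l)-f(x^* )\le\frac{\theta^2}{2\alpha}.$$
   Context: A critical point of a function is a point where its gradient vanishes. $\Lambda^+=\{x\in\mathbb{R}^n:\lambda_{\min}(\nabla^2 f(x))>0\}$, where $\lambda_{\min}$ is the minimum eigenvalue. For $\theta>0$, $L_\theta=\{x\in\mathbb{R}^n:\|\nabla f(x)\|_2\le\theta\}$, and for $x\in L_\theta$, $\Theta(x)$ (which depends on $\theta$) is the largest connected subset of $L_\theta$ that contains $x$. A non-degenerate minimum is a local minimum at which the Hessian is non-singular.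
   Formalization: The formal theorem additionally assumes that Θ(x* ) is bounded; without this the claim fails, e.g. f(x)=√(1+x²), θ=2, l=3/2, where Θ(0)=ℝ=Λ⁺ but f_l has no critical point. *)

theory Defs
  imports "HOL-Analysis.Analysis"
begin

definition grad :: "(real ^ 'n \<Rightarrow> real) \<Rightarrow> real ^ 'n \<Rightarrow> real ^ 'n" where
  "grad f x = (THE D. GDERIV f x :> D)"

definition hessian :: "(real ^ 'n \<Rightarrow> real) \<Rightarrow> real ^ 'n \<Rightarrow> real ^ 'n ^ 'n" where
  "hessian f x = jacobian (grad f) (at x)"

definition C2 :: "(real ^ 'n \<Rightarrow> real) \<Rightarrow> bool" where
  "C2 f \<longleftrightarrow> (\<forall>x. f differentiable (at x)) \<and> (\<forall>x. grad f differentiable (at x)) \<and>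
     continuous_on UNIV (hessian f)"

definition critical_point :: "(real ^ 'n \<Rightarrow> real) \<Rightarrow> real ^ 'n \<Rightarrow> bool" where
  "critical_point f x \<longleftrightarrow> GDERIV f x :> 0"

definition eigenvalues :: "real ^ 'n ^ 'n \<Rightarrow> real set" where
  "eigenvalues A = {c. \<exists>v. v \<noteq> 0 \<and> A *v v = c *\<^sub>R v}"

text \<open>Used only for Hessians of \<open>C2\<close> functions. These are symmetric, so the set of real
  eigenvalues is finite and nonempty and \<open>Min\<close> is meaningful.\<close>

definition lambda_min :: "real ^ 'n ^ 'n \<Rightarrow> real" where
  "lambda_min A = Min (eigenvalues A)"

definition Lambda_plus :: "(real ^ 'n \<Rightarrow> real) \<Rightarrow> (real ^ 'n) set" where
  "Lambda_plus f = {x. lambda_min (hessian f x) > 0}"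

definition L_set :: "(real ^ 'n \<Rightarrow> real) \<Rightarrow> real \<Rightarrow> (real ^ 'n) set" where
  "L_set f \<theta> = {x. norm (grad f x) \<le> \<theta>}"

definition Theta :: "(real ^ 'n \<Rightarrow> real) \<Rightarrow> real \<Rightarrow> real ^ 'n \<Rightarrow> (real ^ 'n) set" where
  "Theta f \<theta> x = connected_component_set (L_set f \<theta>) x"

definition nondegenerate_min :: "(real ^ 'n \<Rightarrow> real) \<Rightarrow> real ^ 'n \<Rightarrow> bool" where
  "nondegenerate_min f x \<longleftrightarrow>
     (\<forall>\<^sub>F y in nhds x. f x \<le> f y) \<and> invertible (hessian f x)"

text \<open>The set \<open>S\<close> need not be convex (the sets \<open>Theta f \<theta> x\<close> in general are not), so the usual
  condition that \<open>f - (\<alpha>/2) \<parallel>\<cdot>\<parallel>\<^sup>2\<close> is convex is imposed on every convex subset of \<open>S\<close>; for convex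
  \<open>S\<close> this is the usual notion. On a general \<open>S\<close> it is implied by the gradient inequality
  \<open>f y \<ge> f x + \<nabla>f(x) \<bullet> (y - x) + (\<alpha>/2) \<parallel>y - x\<parallel>\<^sup>2\<close> for all \<open>x, y \<in> S\<close>, and also by
  \<open>\<nabla>\<^sup>2f \<succeq> \<alpha>I\<close> on \<open>S\<close>.\<close>

definition strongly_convex_on :: "real \<Rightarrow> (real ^ 'n) set \<Rightarrow> (real ^ 'n \<Rightarrow> real) \<Rightarrow> bool" where
  "strongly_convex_on \<alpha> S f \<longleftrightarrow> \<alpha> > 0 \<and>
     (\<forall>C. convex C \<and> C \<subseteq> S \<longrightarrow> convex_on C (\<lambda>x. f x - \<alpha> / 2 * (norm x)\<^sup>2))"

end

theory Submission
  imports Defs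
begin

text \<open>
  The set \<open>K = Theta f \<theta> xs\<close> is compact and the Hessian is positive definite on it. By the inverse
  function theorem \<open>grad f\<close> is a local homeomorphism from \<open>K\<close> to the ball \<open>cball 0 \<theta>\<close>; compactness
  makes it a covering map, and since the ball is simply connected and \<open>K\<close> is connected it is a
  homeomorphism, with inverse \<open>q\<close>. The critical points of \<open>f + l \<bullet> _\<close> in \<open>K\<close> are the preimages of
  \<open>- l\<close>, so \<open>xl = q (- l)\<close> is the only one.

  Since \<open>K\<close> need not be convex, the bound on \<open>f xl - f xs\<close> is obtained along the curve
  \<open>x(t) = q (- t l)\<close>: strong convexity near \<open>x(t)\<close> gives \<open>hessian f x(t) \<ge> \<alpha>\<close>, hence
  \<open>(f \<circ> x)'(t) = t (l \<bullet> (hessian f x(t))\<inverse> l) \<le> t \<parallel>l\<parallel>\<^sup>2 / \<alpha>\<close>, which is integrated over \<open>[0, 1]\<close>.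
\<close>

section \<open>Second-order calculus: symmetry and lower bounds of the Hessian, local minima\<close>

lemma has_real_derivative_compose_GDERIV:
  assumes f: "GDERIV f (\<gamma> t) :> d" and \<gamma>: "(\<gamma> has_vector_derivative \<gamma>') (at t)"
  shows "((\<lambda>t. f (\<gamma> t)) has_real_derivative \<gamma>' \<bullet> d) (at t)"
proof -
  have "((\<lambda>t. f (\<gamma> t)) has_derivative (\<lambda>x. (x *\<^sub>R \<gamma>') \<bullet> d)) (at t)"
    using has_derivative_compose \<gamma> f unfolding has_vector_derivative_def gderiv_def by blast
  moreover have "(\<lambda>x. (x *\<^sub>R \<gamma>') \<bullet> d) = (*) (\<gamma>' \<bullet> d)"
    by (rule ext) simp
  ultimately show ?thesis
    by (simp only: has_field_derivative_def)
qed

text \<open>The mean value theorem in the direction \<open>u\<close> turns the numerator into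
  \<open>h\<close> times a first difference of \<open>g\<close> along \<open>h v\<close>, and
  differentiability of \<open>g\<close> at \<open>x\<close> evaluates that. Swapping
  \<open>u\<close> and \<open>v\<close> yields symmetry of \<open>H\<close>; taking opposite
  directions yields the link to convexity.\<close>

lemma second_difference_tendsto:
  fixes f :: "'a::real_inner \<Rightarrow> real"
  assumes f: "\<And>y. GDERIV f y :> g y" and g: "(g has_derivative H) (at x)"
  shows "((\<lambda>h. (f (x + h *\<^sub>R u + h *\<^sub>R v) - f (x + h *\<^sub>R u) - f (x + h *\<^sub>R v) + f x) / h\<^sup>2)
           \<longlongrightarrow> u \<bullet> H v) (at_right 0)"
proof (rule tendstoI)
  fix e :: real assume "e > 0"
  interpret H: bounded_linear H using g by (rule has_derivative_bounded_linear)
  define M where "M = norm u + norm v + 1"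
  have M: "M > 0" "norm u \<le> M" "norm v \<le> M" "norm u + norm v \<le> M"
    unfolding M_def by (auto simp: add_pos_nonneg add_nonneg_pos)
  \<comment> \<open>Two remainders of size \<open>c h M\<close>, paired with \<open>u\<close> of
    norm at most \<open>M\<close>, add up to \<open>h e / 2\<close>.\<close>
  define c where "c = e / (4 * M\<^sup>2)"
  have "c > 0" using \<open>e > 0\<close> M by (simp add: c_def)
  then obtain d where "d > 0" and d: "\<And>y. norm (y - x) < d \<Longrightarrow>
      norm (g y - g x - H (y - x)) \<le> c * norm (y - x)"
    using g unfolding has_derivative_at_alt by blast
  have "\<forall>\<^sub>F h in at_right 0. h < d / M"
    using \<open>d > 0\<close> M by (intro eventually_at_right_less[THEN eventually_mono] eventually_at_rightI[of 0 "d/M"]) auto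
  then show "\<forall>\<^sub>F h in at_right 0. dist ((f (x + h *\<^sub>R u + h *\<^sub>R v) - f (x + h *\<^sub>R u) - f (x + h *\<^sub>R v) + f x) / h\<^sup>2)
      (u \<bullet> H v) < e"
    using eventually_at_right_less[of 0]
  proof eventually_elim
    case (elim h)
    have h: "h > 0" "h * M < d" using elim M by (auto simp: field_simps)
    \<comment> \<open>\<open>\<phi>\<close> is the increment along \<open>h v\<close> as the base
      point moves along \<open>h u\<close>; \<open>\<phi> 1 - \<phi> 0\<close> is the second
      difference.\<close>
    define \<phi> where "\<phi> s = f (x + (s * h) *\<^sub>R u + h *\<^sub>R v) - f (x + (s * h) *\<^sub>R u)" for s
    define D where "D s = h * (u \<bullet> (g (x + (s * h) *\<^sub>R u + h *\<^sub>R v) - g (x + (s * h) *\<^sub>R u)))" for s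
    have "((\<lambda>s. f (x + (s * h) *\<^sub>R u + w)) has_real_derivative
        (h *\<^sub>R u) \<bullet> g (x + (s * h) *\<^sub>R u + w)) (at s)" for s w
      by (rule has_real_derivative_compose_GDERIV[OF f]) (auto intro!: derivative_eq_intros)
    from this[of "h *\<^sub>R v"] this[of 0] have "DERIV \<phi> s :> D s" for s
      unfolding \<phi>_def D_def by (auto intro!: derivative_eq_intros simp: algebra_simps)
    then obtain s where s: "0 < s" "s < 1" "\<phi> 1 - \<phi> 0 = D s"
      using MVT2[of 0 1 \<phi> D] by auto
    define R where "R y = g y - g x - H (y - x)" for y
    have R: "norm (R (x + z)) \<le> c * (h * M)" if "norm z \<le> h * M" for z
    proof -
      have "norm (R (x + z)) \<le> c * norm z"
        using d[of "x + z"] that h by (simp add: R_def)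
      also have "\<dots> \<le> c * (h * M)" using that \<open>c > 0\<close> by simp
      finally show ?thesis .
    qed
    have "norm ((s * h) *\<^sub>R u + h *\<^sub>R v) \<le> s * h * norm u + h * norm v"
      using s h by (intro order_trans[OF norm_triangle_ineq]) simp
    also have "\<dots> \<le> 1 * h * norm u + h * norm v"
      using s h by (intro add_mono mult_right_mono) auto
    also have "\<dots> \<le> h * M" using M h by (simp flip: distrib_left)
    finally have R1: "norm (R (x + ((s * h) *\<^sub>R u + h *\<^sub>R v))) \<le> c * (h * M)" by (rule R)
    have "norm ((s * h) *\<^sub>R u) \<le> h * M"
      using s h M order_trans[OF mult_left_le_one_le[of "norm u" s], of M]
      by (simp add: mult.commute[of s] mult.assoc)
    then have R2: "norm (R (x + (s * h) *\<^sub>R u)) \<le> c * (h * M)" by (rule R)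
    \<comment> \<open>The contributions of \<open>H u\<close> to the two remainders cancel, leaving
      \<open>h H v\<close>.\<close>
    have "g (x + (s * h) *\<^sub>R u + h *\<^sub>R v) - g (x + (s * h) *\<^sub>R u) - h *\<^sub>R H v
       = R (x + ((s * h) *\<^sub>R u + h *\<^sub>R v)) - R (x + (s * h) *\<^sub>R u)"
      by (simp add: R_def H.add H.scaleR algebra_simps)
    then have "norm (g (x + (s * h) *\<^sub>R u + h *\<^sub>R v) - g (x + (s * h) *\<^sub>R u) - h *\<^sub>R H v)
        \<le> 2 * (c * (h * M))"
      using R1 R2 norm_triangle_ineq4 by (smt (verit))
    then have "\<bar>u \<bullet> (g (x + (s * h) *\<^sub>R u + h *\<^sub>R v) - g (x + (s * h) *\<^sub>R u) - h *\<^sub>R H v)\<bar>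
        \<le> norm u * (2 * (c * (h * M)))"
      by (intro order_trans[OF Cauchy_Schwarz_ineq2] mult_left_mono) auto
    also have "\<dots> \<le> M * (2 * (c * (h * M)))"
      using M h \<open>c > 0\<close> by (intro mult_right_mono) auto
    also have "\<dots> = h * (e / 2)"
      using M by (simp add: c_def field_simps power2_eq_square)
    finally have *: "\<bar>u \<bullet> (g (x + (s * h) *\<^sub>R u + h *\<^sub>R v) - g (x + (s * h) *\<^sub>R u) - h *\<^sub>R H v)\<bar> \<le> h * (e / 2)" .
    have "(\<phi> 1 - \<phi> 0) / h\<^sup>2 - u \<bullet> H v
        = (u \<bullet> (g (x + (s * h) *\<^sub>R u + h *\<^sub>R v) - g (x + (s * h) *\<^sub>R u) - h *\<^sub>R H v)) / h"
      using h unfolding s D_def by (simp add: field_simps power2_eq_square inner_diff_right inner_add_right)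
    then have "\<bar>(\<phi> 1 - \<phi> 0) / h\<^sup>2 - u \<bullet> H v\<bar> \<le> e / 2"
      using * h by (simp only: abs_divide abs_of_pos pos_divide_le_eq mult.commute)
    then show ?case
      using \<open>e > 0\<close> by (simp add: \<phi>_def dist_real_def algebra_simps)
  qed
qed

text \<open>The second difference is symmetric in \<open>u\<close> and \<open>v\<close>, so one
  quotient has both values as its limit.\<close>

corollary gradient_derivative_symmetric:
  fixes f :: "'a::real_inner \<Rightarrow> real"
  assumes f: "\<And>y. GDERIV f y :> g y" and g: "(g has_derivative H) (at x)"
  shows "u \<bullet> H v = v \<bullet> H u"
proof (rule tendsto_unique[OF trivial_limit_at_right_real second_difference_tendsto[OF assms]])
  show "((\<lambda>h. (f (x + h *\<^sub>R u + h *\<^sub>R v) - f (x + h *\<^sub>R u) - f (x + h *\<^sub>R v) + f x) / h\<^sup>2)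
           \<longlongrightarrow> v \<bullet> H u) (at_right 0)"
    using second_difference_tendsto[OF assms, of v u] by (simp add: algebra_simps)
qed

lemma parallelogram_law:
  fixes x y :: "'a::real_inner"
  shows "(norm (x + y))\<^sup>2 + (norm (x - y))\<^sup>2 = 2 * (norm x)\<^sup>2 + 2 * (norm y)\<^sup>2"
  by (simp add: power2_norm_eq_inner inner_add_left inner_add_right inner_diff_left inner_diff_right)

text \<open>With directions \<open>v\<close> and \<open>- v\<close> the second difference is
  \<open>2 f(x) - f(x + h v) - f(x - h v)\<close> and its quotient tends to
  \<open>- (v \<bullet> H v)\<close>. Midpoint convexity at \<open>x\<close> bounds it above, the
  parallelogram law evaluating the quadratic term.\<close>

corollary hessian_lower_bound_of_strongly_convex:
  fixes f :: "'a::real_inner \<Rightarrow> real"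
  assumes f: "\<And>y. GDERIV f y :> g y" and g: "(g has_derivative H) (at x)"
    and convex: "convex_on (ball x r) (\<lambda>y. f y - \<alpha> / 2 * (norm y)\<^sup>2)" and "r > 0"
  shows "\<alpha> * (norm v)\<^sup>2 \<le> v \<bullet> H v"
proof -
  interpret H: bounded_linear H using g by (rule has_derivative_bounded_linear)
  have ev: "\<forall>\<^sub>F h in at_right 0. (f (x + h *\<^sub>R v + h *\<^sub>R - v) - f (x + h *\<^sub>R v) - f (x + h *\<^sub>R - v) + f x) / h\<^sup>2
      \<le> - \<alpha> * (norm v)\<^sup>2"
  proof -
    have "\<forall>\<^sub>F h in at_right 0. h < r / (norm v + 1)"
      using \<open>r > 0\<close>
      by (intro eventually_at_rightI[of 0 "r / (norm v + 1)"]) (auto simp: add_nonneg_pos)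
    then show ?thesis using eventually_at_right_less[of 0]
    proof eventually_elim
      case (elim h)
      have "h * (norm v + 1) < r" using elim by (simp add: less_divide_eq add_nonneg_pos)
      then have "norm (h *\<^sub>R v) < r" using elim by (simp add: algebra_simps)
      then have in_ball: "x + h *\<^sub>R v \<in> ball x r" "x - h *\<^sub>R v \<in> ball x r" 
        by (auto simp: dist_norm)
      let ?q = "\<lambda>y. f y - \<alpha> / 2 * (norm y)\<^sup>2"
      have mid: "(1 - 1/2) *\<^sub>R (x + h *\<^sub>R v) + (1/2) *\<^sub>R (x - h *\<^sub>R v) = x"
        by (simp add: algebra_simps flip: scaleR_add_left)
      have "?q x \<le> (1 - 1/2) * ?q (x + h *\<^sub>R v) + (1/2) * ?q (x - h *\<^sub>R v)"
        using convex_onD[OF convex _ _ in_ball, of "1/2"] unfolding mid by simp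
      moreover have "(norm (x + h *\<^sub>R v))\<^sup>2 + (norm (x - h *\<^sub>R v))\<^sup>2 = 2 * (norm x)\<^sup>2 + 2 * h\<^sup>2 * (norm v)\<^sup>2"
        using parallelogram_law[of x "h *\<^sub>R v"] by (simp add: power_mult_distrib)
      then have "\<alpha> / 2 * ((norm (x + h *\<^sub>R v))\<^sup>2 + (norm (x - h *\<^sub>R v))\<^sup>2)
          = \<alpha> * (norm x)\<^sup>2 + \<alpha> * h\<^sup>2 * (norm v)\<^sup>2"
        by (simp add: distrib_left)
      ultimately have "2 * f x - f (x + h *\<^sub>R v) - f (x - h *\<^sub>R v) \<le> - \<alpha> * (norm v)\<^sup>2 * h\<^sup>2"
        by (simp add: algebra_simps)
      then show ?case using elim by (simp add: pos_divide_le_eq algebra_simps)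
    qed
  qed
  from tendsto_upperbound[OF second_difference_tendsto[OF f g, of v "- v"] ev]
  show ?thesis by (simp add: H.neg)
qed

text \<open>Near \<open>x\<close> the linearisation error of \<open>g\<close> is at most
  \<open>m\<close> times the distance, which positive definiteness absorbs exactly. So the gradient
  points weakly outward, and \<open>f\<close> does not decrease along segments issuing from
  \<open>x\<close>.\<close>

lemma local_min_of_gradient_derivative_positive:
  fixes f :: "'a::euclidean_space \<Rightarrow> real"
  assumes f: "\<And>y. GDERIV f y :> g y" and g: "(g has_derivative H) (at x)"
    and "g x = 0" and pos: "\<And>v. m * (norm v)\<^sup>2 \<le> v \<bullet> H v" and "m > 0"
  shows "\<forall>\<^sub>F y in nhds x. f x \<le> f y"
proof -
  interpret H: bounded_linear H using g by (rule has_derivative_bounded_linear)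
  obtain d where "d > 0" and d: "\<And>y. norm (y - x) < d \<Longrightarrow>
      norm (g y - g x - H (y - x)) \<le> m * norm (y - x)"
    using g \<open>m > 0\<close> unfolding has_derivative_at_alt by blast
  have mono: "0 \<le> (y - x) \<bullet> g y" if "norm (y - x) < d" for y
  proof -
    have "\<bar>(y - x) \<bullet> (g y - H (y - x))\<bar> \<le> norm (y - x) * (m * norm (y - x))"
      using d[OF that] \<open>g x = 0\<close>
      by (intro order_trans[OF Cauchy_Schwarz_ineq2] mult_left_mono) auto
    with pos[of "y - x"] show ?thesis
      by (simp add: inner_diff_right power2_eq_square algebra_simps)
  qed
  have "f x \<le> f y" if "dist y x < d" for y
  proof -
    have deriv: "((\<lambda>t. f (x + t *\<^sub>R (y - x))) has_real_derivative (y - x) \<bullet> g (x + t *\<^sub>R (y - x))) (at t)" for t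
      by (rule has_real_derivative_compose_GDERIV[OF f]) (auto intro!: derivative_eq_intros)
    have "f (x + 0 *\<^sub>R (y - x)) \<le> f (x + 1 *\<^sub>R (y - x))"
    proof (rule DERIV_nonneg_imp_increasing_open[of 0 1 "\<lambda>t. f (x + t *\<^sub>R (y - x))"])
      fix t :: real assume t: "0 < t" "t < 1"
      have "norm (x + t *\<^sub>R (y - x) - x) \<le> norm (y - x)"
        using t by (simp add: mult_left_le_one_le)
      \<comment> \<open>The displacement from \<open>x\<close> is \<open>t\<close> times
        \<open>y - x\<close>; the factor \<open>t > 0\<close> is divided out next.\<close>
      with mono[of "x + t *\<^sub>R (y - x)"] that have "0 \<le> t * ((y - x) \<bullet> g (x + t *\<^sub>R (y - x)))"
        by (simp add: dist_norm)
      with t have "0 \<le> (y - x) \<bullet> g (x + t *\<^sub>R (y - x))" by (simp add: zero_le_mult_iff)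
      then show "\<exists>z. ((\<lambda>t. f (x + t *\<^sub>R (y - x))) has_real_derivative z) (at t) \<and> 0 \<le> z"
        using deriv by blast
    next
      show "continuous_on {0..1} (\<lambda>t. f (x + t *\<^sub>R (y - x)))"
        using deriv DERIV_isCont by (intro continuous_at_imp_continuous_on) blast
    qed simp
    then show ?thesis by simp
  qed
  with \<open>d > 0\<close> show ?thesis unfolding eventually_nhds_metric by blast
qed

section \<open>Compact local homeomorphisms and coverings of simply connected spaces\<close>

lemma finite_pairwise_disjoint_open_neighbourhoods:
  fixes F :: "'a::t2_space set"
  assumes "finite F"
  obtains N where "\<And>x. x \<in> F \<Longrightarrow> x \<in> N x \<and> open (N x)" "disjoint_family_on N F"
proof -
  have "\<exists>A B. x \<noteq> z \<longrightarrow> open A \<and> open B \<and> x \<in> A \<and> z \<in> B \<and> A \<inter> B = {}" for x z :: 'a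
    using hausdorff[of x z] by meson
  then obtain A B where AB: "\<And>x z :: 'a. x \<noteq> z \<Longrightarrow>
      open (A x z) \<and> open (B x z) \<and> x \<in> A x z \<and> z \<in> B x z \<and> A x z \<inter> B x z = {}"
    by metis
  show ?thesis
  proof (rule that)
    \<comment> \<open>For distinct points \<open>x\<close> and \<open>z\<close>, the set at
      \<open>x\<close> lies in \<open>A x z\<close> and the set at \<open>z\<close> in
      \<open>B x z\<close>, which are disjoint; hence both roles occur in the intersection.\<close>
    show "x \<in> (\<Inter>z\<in>F - {x}. A x z \<inter> B z x) \<and> open (\<Inter>z\<in>F - {x}. A x z \<inter> B z x)" for x
      using AB assms by (fastforce intro!: open_INT)
    show "disjoint_family_on (\<lambda>x. \<Inter>z\<in>F - {x}. A x z \<inter> B z x) F"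
      using AB by (fastforce simp: disjoint_family_on_def)
  qed
qed

text \<open>Local homeomorphy makes \<open>p\<close> open and compactness makes it closed, so its
  nonempty image is clopen in the connected \<open>S\<close>. Fibres are compact and discrete, hence
  finite, and finitely many sheets can be shrunk over a common neighbourhood.\<close>

lemma compact_local_homeomorphism_imp_covering_space:
  fixes p :: "'a::t2_space \<Rightarrow> 'b::t2_space"
  assumes K: "compact K" "K \<noteq> {}" and cont: "continuous_on K p"
    and S: "connected S" and pK: "p ` K \<subseteq> S"
    and local: "\<And>x. x \<in> K \<Longrightarrow> \<exists>U q. x \<in> U \<and> openin (top_of_set K) U \<and>
                  openin (top_of_set S) (p ` U) \<and> homeomorphism U (p ` U) p q"
  shows "covering_space K p S"
proof -
  have open_image: "openin (top_of_set S) (p ` N)" if N: "openin (top_of_set K) N" for N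
  proof (subst openin_subopen, intro ballI)
    fix y assume "y \<in> p ` N"
    then obtain x where x: "x \<in> N" "y = p x" by auto
    then have "x \<in> K" using openin_imp_subset[OF N] by auto
    then obtain U q where U: "x \<in> U" "openin (top_of_set K) U"
      "openin (top_of_set S) (p ` U)" "homeomorphism U (p ` U) p q" using local by blast
    have "openin (top_of_set U) (U \<inter> N)"
      using U N openin_imp_subset[OF U(2)] openin_subset_trans[of K "U \<inter> N" U] by auto
    then have "openin (top_of_set (p ` U)) (p ` (U \<inter> N))"
      using homeomorphism_imp_open_map[OF U(4)] by blast
    then have "openin (top_of_set S) (p ` (U \<inter> N))" using U(3) openin_trans by blast
    moreover have "y \<in> p ` (U \<inter> N)" using x U by auto
    ultimately show "\<exists>T. openin (top_of_set S) T \<and> y \<in> T \<and> T \<subseteq> p ` N" by blast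
  qed
  have closed_image: "closedin (top_of_set S) (p ` C)" if "closedin (top_of_set K) C" for C
  proof -
    have "compact C" using that K(1) closedin_compact by blast
    moreover have "C \<subseteq> K" using that closedin_imp_subset by blast
    ultimately show ?thesis
      using cont pK by (intro closed_subset compact_imp_closed compact_continuous_image)
        (auto intro: continuous_on_subset)
  qed
  have surj: "p ` K = S"
    using S open_image[of K] closed_image[of K] K(2) by (auto simp: connected_clopen)
  show ?thesis
  proof (rule covering_spaceI[OF cont surj])
    fix y assume y: "y \<in> S"
    define F where "F = K \<inter> p -` {y}"
    have "\<exists>U q. x \<in> U \<and> openin (top_of_set K) U \<and>
                  openin (top_of_set S) (p ` U) \<and> homeomorphism U (p ` U) p q" if "x \<in> F" for x
      using local that by (auto simp: F_def)
    then obtain U q where U: "\<And>x. x \<in> F \<Longrightarrow> x \<in> U x \<and> openin (top_of_set K) (U x) \<and>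
        openin (top_of_set S) (p ` U x) \<and> homeomorphism (U x) (p ` U x) p (q x)" by metis
    have "closedin (top_of_set K) F"
      unfolding F_def by (intro continuous_closedin_preimage cont) auto
    then have "compact F" using K(1) closedin_compact by blast
    \<comment> \<open>Injectivity of \<open>p\<close> on \<open>U x\<close> isolates
      \<open>x\<close> in its fibre, so a finite subcover already contains the whole fibre among its
      centres.\<close>
    have "finite F"
    proof -
      have "\<exists>V. open V \<and> U x = K \<inter> V" if "x \<in> F" for x
        using U[OF that] by (auto simp: openin_open)
      then obtain V where V: "\<And>x. x \<in> F \<Longrightarrow> open (V x) \<and> U x = K \<inter> V x" by metis
      have single: "F \<inter> V x \<subseteq> {x}" if "x \<in> F" for x
      proof
        fix z assume "z \<in> F \<inter> V x"
        then have "z \<in> U x" "p z = p x" using V[OF that] that by (auto simp: F_def)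
        then show "z \<in> {x}" using U[OF that] by (metis homeomorphism_apply1 singletonI)
      qed
      obtain G where G: "G \<subseteq> F" "finite G" "F \<subseteq> (\<Union>x\<in>G. V x)"
        using \<open>compact F\<close> V U
        by (rule_tac compactE_image[of F F V]) auto
      then have "F \<subseteq> G" using single by blast
      then show ?thesis using G finite_subset by blast
    qed
    then obtain N where N: "\<And>x. x \<in> F \<Longrightarrow> x \<in> N x \<and> open (N x)" "disjoint_family_on N F"
      by (metis finite_pairwise_disjoint_open_neighbourhoods)
    \<comment> \<open>The first factor lets every sheet cover all of \<open>W\<close>. Removing the
      image of the rest of \<open>K\<close>, which is closed, leaves no point over \<open>W\<close>
      outside the sheets.\<close>
    define W where "W = (\<Inter>x\<in>F. p ` (U x \<inter> N x)) \<inter> (S - p ` (K - (\<Union>x\<in>F. U x \<inter> N x)))"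
    have UN: "openin (top_of_set K) (U x \<inter> N x)" if "x \<in> F" for x
      using U[OF that] N(1)[OF that] openin_Int_open by blast
    have "F \<noteq> {}" using y surj by (auto simp: F_def)
    have W: "openin (top_of_set S) W"
      unfolding W_def using \<open>finite F\<close> \<open>F \<noteq> {}\<close> UN
      by (intro openin_Int openin_INT2 openin_diff closed_image closedin_diff open_image[OF UN]) auto
    have "y \<in> W" using y U N(1) by (auto simp: W_def F_def)
    let ?v = "(\<lambda>x. U x \<inter> N x \<inter> p -` W) ` F"
    show "\<exists>T. y \<in> T \<and> openin (top_of_set S) T \<and>
            (\<exists>v. \<Union>v = K \<inter> p -` T \<and> (\<forall>u\<in>v. openin (top_of_set K) u) \<and>
                 pairwise disjnt v \<and> (\<forall>u\<in>v. \<exists>q. homeomorphism u T p q))"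
    proof (intro exI[of _ W] exI[of _ ?v] conjI ballI)
      show "\<Union> ?v = K \<inter> p -` W"
      proof (intro equalityI subsetI)
        fix z assume "z \<in> K \<inter> p -` W"
        then show "z \<in> \<Union> ?v" by (auto simp: W_def)
      qed (use UN openin_imp_subset in blast)
      show "pairwise disjnt ?v"
        using N(2) unfolding pairwise_image disjoint_family_on_def
        by (fastforce intro!: pairwiseI simp: disjnt_def)
    next
      fix u assume "u \<in> ?v"
      then obtain x where x: "x \<in> F" "u = U x \<inter> N x \<inter> p -` W" by auto
      have "openin (top_of_set K) (K \<inter> p -` W)"
        using continuous_openin_preimage[OF cont _ W] pK by auto
      moreover have "u = (U x \<inter> N x) \<inter> (K \<inter> p -` W)"
        using x UN[OF x(1)] openin_imp_subset by blast
      ultimately show "openin (top_of_set K) u" using UN[OF x(1)] openin_Int by blast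
      have "p ` u = W" 
      proof (intro equalityI subsetI)
        fix z assume "z \<in> W"
        then obtain w where "w \<in> U x \<inter> N x" "z = p w" using x(1) by (auto simp: W_def)
        then show "z \<in> p ` u" using \<open>z \<in> W\<close> x(2) by auto
      qed (use x in auto)
      then have "homeomorphism u W p (q x)"
        using homeomorphism_of_subsets[of "U x" "p ` U x" p "q x" u W] U[OF x(1)] x
        by (metis image_mono inf.cobounded1 inf_assoc)
      then show "\<exists>q. homeomorphism u W p q" by blast
    qed (use \<open>y \<in> W\<close> W in auto)
  qed
qed

text \<open>The identity of \<open>S\<close> lifts to a section \<open>q\<close> through a base
  point \<open>a\<close>. On \<open>C\<close>, both \<open>q \<circ> p\<close> and the identity lift
  \<open>p\<close> and agree at \<open>a\<close>, so they coincide by connectedness.\<close>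

lemma simply_connected_covering_space_homeomorphism:
  fixes p :: "'a::real_normed_vector \<Rightarrow> 'b::real_normed_vector"
  assumes cov: "covering_space C p S" and C: "connected C"
    and S: "simply_connected S" "locally path_connected S"
  obtains q where "homeomorphism C S p q"
proof (cases "C = {}")
  case True
  then show ?thesis
    using cov covering_space_imp_surjective that by (fastforce simp: homeomorphism_def)
next
  case False
  then obtain a where a: "a \<in> C" by auto
  have p: "continuous_on C p" "p ` C = S"
    using covering_space_imp_continuous[OF cov] covering_space_imp_surjective[OF cov] by auto
  then obtain q where q: "continuous_on S q" "q \<in> S \<rightarrow> C" "q (p a) = a" "\<And>y. y \<in> S \<Longrightarrow> p (q y) = y"
    using covering_space_lift_strong[OF cov a _ S continuous_on_id, of "p a"] a by auto
  have qp: "q (p x) = x" if "x \<in> C" for x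
  proof (rule covering_space_lift_unique[OF cov, of "\<lambda>x. q (p x)" a "\<lambda>x. x" C p])
    show "continuous_on C (\<lambda>x. q (p x))"
      using p q(1) by (intro continuous_on_compose2[OF q(1)]) auto
  qed (use p q a C that in auto)
  have "homeomorphism C S p q"
    using p q qp by (auto simp: homeomorphism_def) (metis imageI qp)
  then show ?thesis by (rule that)
qed

section \<open>Least eigenvalues of symmetric matrices\<close>

text \<open>Rayleigh's principle: the quadratic form attains its minimum on the compact unit sphere,
  and a minimiser is an eigenvector.\<close>

lemma symmetric_operator_min_eigenvector:
  fixes H :: "'a::euclidean_space \<Rightarrow> 'a"
  assumes H: "linear H" and sym: "\<And>u v. u \<bullet> H v = v \<bullet> H u"
  obtains e m where "norm e = 1" "H e = m *\<^sub>R e" "\<And>v. m * (norm v)\<^sup>2 \<le> v \<bullet> H v"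
proof -
  interpret H: linear H by fact
  have "continuous_on (sphere 0 1) (\<lambda>v. v \<bullet> H v)"
    using H by (intro continuous_intros linear_continuous_on) (simp add: linear_linear)
  moreover have "sphere (0::'a) 1 \<noteq> {}" by simp
  ultimately obtain e where e: "e \<in> sphere 0 1" and min: "\<And>v. v \<in> sphere 0 1 \<Longrightarrow> e \<bullet> H e \<le> v \<bullet> H v"
    using continuous_attains_inf[of "sphere 0 1" "\<lambda>v. v \<bullet> H v"] by auto
  define m where "m = e \<bullet> H e"
  have ge: "m * (norm v)\<^sup>2 \<le> v \<bullet> H v" for v
  proof (cases "v = 0")
    case False
    then have "m \<le> (v /\<^sub>R norm v) \<bullet> H (v /\<^sub>R norm v)"
      unfolding m_def by (intro min) simp
    also have "\<dots> = (v \<bullet> H v) / (norm v)\<^sup>2"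
      by (simp add: H.scale power2_eq_square divide_inverse mult_ac)
    finally show ?thesis using False by (simp add: field_simps)
  qed (simp add: H.zero)
  \<comment> \<open>\<open>B = H - m I\<close> is positive semidefinite with \<open>e \<bullet> B e = 0\<close>; if \<open>w = B e\<close> were nonzero, the form
    would become negative at \<open>e - s w\<close> for small \<open>s > 0\<close>.\<close>
  define B where "B v = H v - m *\<^sub>R v" for v
  define w where "w = B e"
  define c where "c = w \<bullet> B w"
  have B: "0 \<le> v \<bullet> B v" for v
    using ge[of v] by (simp add: B_def inner_diff_right power2_norm_eq_inner)
  have B_diff: "B (u - s *\<^sub>R v) = B u - s *\<^sub>R B v" for u v s
    by (simp add: B_def H.diff H.scale algebra_simps)
  have eBe: "e \<bullet> B e = 0"
    using e by (simp add: B_def inner_diff_right m_def norm_eq_1)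
  have "u \<bullet> B v = v \<bullet> B u" for u v
    using sym[of u v] by (simp add: B_def inner_diff_right inner_commute)
  then have sym': "e \<bullet> B w = w \<bullet> w" unfolding w_def by metis
  have "w = 0"
  proof (rule ccontr)
    assume "w \<noteq> 0"
    \<comment> \<open>This makes \<open>s * c\<close> at most \<open>w \<bullet> w\<close>, against
      the lower bound \<open>2 * (w \<bullet> w)\<close> derived below; the summand 1 covers
      \<open>c = 0\<close>.\<close>
    define s where "s = (w \<bullet> w) / (c + 1)"
    have c: "c \<ge> 0" using B by (simp add: c_def)
    have s: "s > 0" using c \<open>w \<noteq> 0\<close> by (simp add: s_def)
    have "0 \<le> (e - s *\<^sub>R w) \<bullet> B (e - s *\<^sub>R w)" by (rule B)
    also have "B (e - s *\<^sub>R w) = w - s *\<^sub>R B w"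
      by (simp add: B_diff flip: w_def)
    also have "(e - s *\<^sub>R w) \<bullet> (w - s *\<^sub>R B w) = s * (s * c - 2 * (w \<bullet> w))"
      using eBe sym' by (simp add: inner_diff_left inner_diff_right c_def w_def[symmetric] algebra_simps)
    finally have "2 * (w \<bullet> w) \<le> s * c" using s by (simp add: zero_le_mult_iff)
    also have "\<dots> \<le> s * (c + 1)" using s by simp
    also have "\<dots> = w \<bullet> w" using c by (simp add: s_def)
    finally show False using \<open>w \<noteq> 0\<close> by simp
  qed
  then show ?thesis
    using e ge by (intro that[of e m]) (auto simp: w_def B_def)
qed

text \<open>Eigenvectors to distinct eigenvalues are orthogonal, hence independent. Finiteness is
  what makes the \<open>Min\<close> in \<open>lambda_min\<close> a genuine lower bound.\<close>

lemma finite_eigenvalues_symmetric: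
  fixes A :: "real ^ 'n ^ 'n"
  assumes sym: "\<And>u v. u \<bullet> (A *v v) = v \<bullet> (A *v u)"
  shows "finite (eigenvalues A)"
proof -
  have "\<forall>c\<in>eigenvalues A. \<exists>v. v \<noteq> 0 \<and> A *v v = c *\<^sub>R v"
    by (simp add: eigenvalues_def)
  then obtain w where w: "\<And>c. c \<in> eigenvalues A \<Longrightarrow> w c \<noteq> 0 \<and> A *v w c = c *\<^sub>R w c"
    by metis
  have orth: "w c \<bullet> w d = 0" if "c \<in> eigenvalues A" "d \<in> eigenvalues A" "c \<noteq> d" for c d
  proof -
    have "d * (w c \<bullet> w d) = c * (w c \<bullet> w d)"
      using sym[of "w c" "w d"] w that by (simp add: inner_commute)
    then show ?thesis using that by simp
  qed
  have "inj_on w (eigenvalues A)"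
    using orth w by (metis inj_onI inner_eq_zero_iff)
  moreover have "independent (w ` eigenvalues A)"
    using orth w by (intro pairwise_orthogonal_independent)
      (force simp: pairwise_def orthogonal_def)+
  then have "finite (w ` eigenvalues A)"
    using independent_bound by blast
  ultimately show ?thesis using finite_image_iff by blast
qed

text \<open>The Rayleigh minimum is itself an eigenvalue, so it is at least
  \<open>lambda_min A\<close>.\<close>

lemma positive_definite_if_lambda_min_pos:
  fixes A :: "real ^ 'n ^ 'n"
  assumes sym: "\<And>u v. u \<bullet> (A *v v) = v \<bullet> (A *v u)" and pos: "lambda_min A > 0"
  obtains m where "m > 0" "\<And>v. m * (norm v)\<^sup>2 \<le> v \<bullet> (A *v v)"
proof -
  obtain e m where e: "norm e = 1" "A *v e = m *\<^sub>R e" "\<And>v. m * (norm v)\<^sup>2 \<le> v \<bullet> (A *v v)"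
    using symmetric_operator_min_eigenvector[OF matrix_vector_mul_linear sym] by blast
  then have "m \<in> eigenvalues A"
    unfolding eigenvalues_def by (metis (mono_tags, lifting) mem_Collect_eq norm_zero zero_neq_one)
  then have "lambda_min A \<le> m"
    using finite_eigenvalues_symmetric[OF sym] by (simp add: lambda_min_def)
  then show ?thesis using pos e by (intro that[of m]) auto
qed

lemma invertible_if_positive_definite:
  fixes A :: "real ^ 'n ^ 'n"
  assumes "m > 0" "\<And>v. m * (norm v)\<^sup>2 \<le> v \<bullet> (A *v v)"
  shows "invertible A"
proof -
  have "v = 0" if "A *v v = 0" for v
    using assms(2)[of v] \<open>m > 0\<close> that by (simp add: mult_le_0_iff)
  then show ?thesis
    by (metis invertible_left_inverse matrix_left_invertible_ker)
qed

section \<open>Gradient and Hessian of a \<open>C2\<close> function; local invertibility of the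
  gradient\<close>

lemma grad_eqI: "GDERIV f x :> D \<Longrightarrow> grad f x = D"
  unfolding grad_def
proof (rule the_equality)
  fix D' assume "GDERIV f x :> D" "GDERIV f x :> D'"
  then have "(\<lambda>h. h \<bullet> D') = (\<lambda>h. h \<bullet> D)"
    unfolding gderiv_def using has_derivative_unique by blast
  then show "D' = D" by (metis vector_eq_ldot)
qed

lemma differentiable_imp_GDERIV_grad:
  assumes "f differentiable (at x)"
  shows "GDERIV f x :> grad f x"
proof -
  obtain f' where f': "(f has_derivative f') (at x)"
    using assms by (auto simp: differentiable_def)
  then have "linear f'" using has_derivative_linear by blast
  \<comment> \<open>Riesz representation of the functional \<open>f'\<close> by the vector
    \<open>adjoint f' 1\<close>.\<close>
  then have "f' = (\<lambda>h. h \<bullet> adjoint f' 1)"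
    by (simp add: adjoint_works fun_eq_iff)
  then have "GDERIV f x :> adjoint f' 1" using f' by (simp add: gderiv_def)
  then show ?thesis using grad_eqI by metis
qed

lemma C2_has_derivative_grad:
  assumes "C2 f"
  shows "(grad f has_derivative (*v) (hessian f x)) (at x)"
  using assms jacobian_works[of "grad f" "at x"] unfolding C2_def hessian_def by blast

lemma C2_continuous_on_grad: "C2 f \<Longrightarrow> continuous_on S (grad f)"
  using C2_has_derivative_grad has_derivative_continuous
  by (intro continuous_at_imp_continuous_on) blast

lemma continuous_on_matrix_vector_mult:
  fixes A :: "'a::topological_space \<Rightarrow> real ^ 'n ^ 'm"
  assumes "continuous_on S A"
  shows "continuous_on S (\<lambda>x. A x *v v)"
  unfolding matrix_vector_mult_def
  by (intro continuous_on_vec_lambda continuous_on_sum continuous_on_mult continuous_on_const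
      continuous_on_component assms)

text \<open>The inverse function theorem, for which the Hessian matrices are recast as a continuous
  family of bounded linear maps with a left inverse at \<open>x\<close>.\<close>

lemma grad_local_homeomorphism:
  fixes f :: "real ^ 'n \<Rightarrow> real"
  assumes C2: "C2 f" and inv: "invertible (hessian f x)"
  obtains U V h where "open U" "x \<in> U" "open V" "grad f x \<in> V" "homeomorphism U V (grad f) h"
proof -
  define F where "F y = Blinfun ((*v) (hessian f y))" for y
  have F: "blinfun_apply (F y) = (*v) (hessian f y)" for y
    unfolding F_def by (intro bounded_linear_Blinfun_apply matrix_vector_mul_bounded_linear)
  have "continuous_on UNIV F"
    using C2 by (intro continuous_on_blinfun_componentwise)
      (simp add: F C2_def continuous_on_matrix_vector_mult)
  moreover obtain A where "A ** hessian f x = mat 1"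
    using inv by (auto simp: invertible_def)
  then have "Blinfun ((*v) A) o\<^sub>L F x = id_blinfun"
    by (intro blinfun_eqI)
      (simp add: F bounded_linear_Blinfun_apply matrix_vector_mul_bounded_linear
        matrix_vector_mul_assoc)
  ultimately obtain U V h h' where "open U" "x \<in> U" "open V" "grad f x \<in> V" "homeomorphism U V (grad f) h"
    using inverse_function_theorem[of UNIV "grad f" F x "Blinfun ((*v) A)"]
      C2_has_derivative_grad[OF C2] F by (metis UNIV_I open_UNIV)
  then show ?thesis by (rule that)
qed

section \<open>The gradient as a homeomorphism from a component onto a ball\<close>

text \<open>Where \<open>g x\<close> lies on the boundary of \<open>S\<close>, no full neighbourhood
  of \<open>x\<close> need lie in the preimage. Convexity of \<open>S\<close> helps: a small ball
  about \<open>g x\<close> meets \<open>S\<close> in a connected set, whose image under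
  \<open>h\<close> is connected and so stays in the component of \<open>x\<close>.\<close>

lemma component_of_preimage_local_homeomorphism:
  fixes g :: "'a::real_normed_vector \<Rightarrow> 'b::real_normed_vector"
  assumes hom: "homeomorphism U V g h" and U: "open U" "x \<in> U" and V: "open V"
    and S: "convex S" and x: "x \<in> connected_component_set (g -` S) a"
  obtains N where "x \<in> N" "openin (top_of_set (connected_component_set (g -` S) a)) N"
    "openin (top_of_set S) (g ` N)" "homeomorphism N (g ` N) g h"
proof -
  let ?K = "connected_component_set (g -` S) a"
  have gx: "g x \<in> V" using U hom by (auto simp: homeomorphism_def)
  then obtain e where e: "e > 0" "ball (g x) e \<subseteq> V" using V openE by blast
  define B where "B = ball (g x) e"
  have "B \<subseteq> V" using e by (simp add: B_def)
  define N where "N = h ` (B \<inter> S)"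
  have hg: "h (g z) = z" if "z \<in> U" for z using hom that by (simp add: homeomorphism_def)
  have gh: "g (h y) = y" "h y \<in> U" if "y \<in> B" for y
    using hom that \<open>B \<subseteq> V\<close> by (auto simp: homeomorphism_def)
  have K: "?K \<subseteq> g -` S" by (rule connected_component_subset)
  have "g x \<in> B \<inter> S" using e x K by (auto simp: B_def)
  then have "x \<in> N" unfolding N_def using hg[OF U(2)] by (metis imageI)
  have gN: "g ` N = B \<inter> S" using gh by (force simp: N_def)
  have "connected N"
    unfolding N_def using hom \<open>B \<subseteq> V\<close> S
    by (intro connected_continuous_image convex_connected convex_Int)
      (auto simp: B_def homeomorphism_def intro: continuous_on_subset)
  then have "N \<subseteq> ?K"
    using \<open>x \<in> N\<close> gN connected_component_maximal[of x N "g -` S"] connected_component_eq[OF x] by blast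
  have "open (U \<inter> g -` B)"
    using hom U V by (intro continuous_open_preimage) (auto simp: homeomorphism_def B_def)
  moreover have "N = ?K \<inter> (U \<inter> g -` B)"
  proof (intro equalityI subsetI)
    fix z assume "z \<in> ?K \<inter> (U \<inter> g -` B)"
    then have "z = h (g z)" "g z \<in> B \<inter> S" using hg K by auto
    then show "z \<in> N" unfolding N_def by blast
  qed (use \<open>N \<subseteq> ?K\<close> gh in \<open>auto simp: N_def\<close>)
  ultimately have "openin (top_of_set ?K) N" by (auto simp: openin_open)
  moreover have "openin (top_of_set S) (g ` N)"
    unfolding gN B_def by (simp add: openin_open_Int Int_commute)
  moreover have "homeomorphism N (g ` N) g h"
    using hom gh \<open>B \<subseteq> V\<close> by (intro homeomorphism_of_subsets[OF hom]) (auto simp: gN N_def)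
  ultimately show ?thesis using \<open>x \<in> N\<close> that by blast
qed

lemma grad_homeomorphism_Theta:
  fixes f :: "real ^ 'n \<Rightarrow> real"
  assumes C2: "C2 f" and bounded: "bounded (Theta f \<theta> xs)" and xs: "norm (grad f xs) \<le> \<theta>"
    and inv: "\<And>x. x \<in> Theta f \<theta> xs \<Longrightarrow> invertible (hessian f x)"
  obtains q where "homeomorphism (Theta f \<theta> xs) (cball 0 \<theta>) (grad f) q"
proof -
  define K where "K = Theta f \<theta> xs"
  have L: "L_set f \<theta> = grad f -` cball 0 \<theta>" by (auto simp: L_set_def)
  have K: "K = connected_component_set (grad f -` cball 0 \<theta>) xs"
    by (simp add: K_def Theta_def L)
  note cont = C2_continuous_on_grad[OF C2]
  have "closed (grad f -` cball 0 \<theta>)"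
    using continuous_closed_preimage[OF cont[of UNIV], of "cball 0 \<theta>"] by simp
  \<comment> \<open>A component of a closed set is closed, so boundedness gives compactness.\<close>
  then have "compact K"
    using bounded closed_connected_component unfolding compact_eq_bounded_closed K_def[symmetric]
    by (simp add: K)
  have "xs \<in> K" using xs by (simp add: K)
  have "covering_space K (grad f) (cball 0 \<theta>)"
  proof (rule compact_local_homeomorphism_imp_covering_space[OF \<open>compact K\<close> _ cont])
    show "grad f ` K \<subseteq> cball 0 \<theta>" using connected_component_subset unfolding K by blast
    fix x assume x: "x \<in> K"
    obtain U V h where UV: "open U" "x \<in> U" "open V" "grad f x \<in> V" "homeomorphism U V (grad f) h"
      using grad_local_homeomorphism[OF C2 inv] x unfolding K_def by blast
    obtain N where "x \<in> N" "openin (top_of_set K) N" "openin (top_of_set (cball 0 \<theta>)) (grad f ` N)"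
      "homeomorphism N (grad f ` N) (grad f) h"
      using component_of_preimage_local_homeomorphism[OF UV(5,1,2,3) convex_cball x[unfolded K]]
      unfolding K by blast
    then show "\<exists>U q. x \<in> U \<and> openin (top_of_set K) U \<and>
        openin (top_of_set (cball 0 \<theta>)) (grad f ` U) \<and> homeomorphism U (grad f ` U) (grad f) q"
      by blast
  qed (use \<open>xs \<in> K\<close> in auto)
  moreover have "connected K" by (simp add: K)
  ultimately obtain q where "homeomorphism K (cball 0 \<theta>) (grad f) q"
    using simply_connected_covering_space_homeomorphism convex_imp_simply_connected
      convex_imp_locally_path_connected convex_cball by metis
  then show ?thesis using that by (simp add: K_def)
qed

section \<open>Growth of the critical value under strong convexity\<close>

lemma strongly_convex_critical_value_bound:
  fixes f :: "real ^ 'n \<Rightarrow> real"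
  assumes C2: "C2 f" and hom: "homeomorphism (Theta f \<theta> xs) (cball 0 \<theta>) (grad f) q"
    and sc: "strongly_convex_on \<alpha> (Theta f \<theta> xs) f" and l: "norm l < \<theta>"
  shows "f (q (- l)) - f (q 0) \<le> (norm l)\<^sup>2 / (2 * \<alpha>)"
proof -
  define K where "K = Theta f \<theta> xs"
  have "\<alpha> > 0" using sc by (simp add: strongly_convex_on_def)
  have f: "GDERIV f y :> grad f y" for y
    using C2 differentiable_imp_GDERIV_grad by (auto simp: C2_def)
  have hom: "homeomorphism K (cball 0 \<theta>) (grad f) q" using hom by (simp add: K_def)
  have "compact K"
    using hom compact_cball homeomorphic_compactness homeomorphic_def by blast
  have qK: "q y \<in> K" "grad f (q y) = y" if "norm y \<le> \<theta>" for y
    using hom that by (auto simp: homeomorphism_def)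
  \<comment> \<open>Strong convexity speaks only of convex subsets of \<open>K\<close>. The strict
    inequality on the gradient provides one: a ball about \<open>x\<close> inside
    \<open>L_set f \<theta>\<close>, which is connected and hence within the component.\<close>
  have lower: "\<alpha> * (norm v)\<^sup>2 \<le> v \<bullet> (hessian f x *v v)" if x: "x \<in> K" "norm (grad f x) < \<theta>" for x v
  proof -
    have "open (grad f -` ball 0 \<theta>)"
      using open_vimage[OF open_ball C2_continuous_on_grad[OF C2]] .
    then obtain r where r: "r > 0" "ball x r \<subseteq> grad f -` ball 0 \<theta>"
      using x openE[of "grad f -` ball 0 \<theta>" x] by auto
    then have "ball x r \<subseteq> L_set f \<theta>" by (auto simp: L_set_def)
    then have "ball x r \<subseteq> connected_component_set (L_set f \<theta>) x"
      using r by (intro connected_component_maximal) auto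
    also have "\<dots> = K"
      using x connected_component_eq unfolding K_def Theta_def by blast
    finally have "convex_on (ball x r) (\<lambda>x. f x - \<alpha> / 2 * (norm x)\<^sup>2)"
      using sc by (simp add: strongly_convex_on_def K_def)
    then show ?thesis
      using hessian_lower_bound_of_strongly_convex[OF f C2_has_derivative_grad[OF C2]] r by blast
  qed
  \<comment> \<open>Subtracting the integrated bound turns the integration over [0, 1] into
    monotonicity of \<open>\<phi>\<close>.\<close>
  define \<phi> where "\<phi> t = f (q (t *\<^sub>R - l)) - t\<^sup>2 * ((norm l)\<^sup>2 / (2 * \<alpha>))" for t
  have "\<phi> 1 \<le> \<phi> 0"
  proof (rule DERIV_nonpos_imp_nonincreasing[of 0 1])
    fix t :: real assume t: "0 \<le> t" "t \<le> 1"
    define y where "y = t *\<^sub>R - l"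
    have y: "norm y < \<theta>" using t l mult_left_le_one_le[of "norm l" t] by (simp add: y_def)
    define x where "x = q y"
    have x: "x \<in> K" "grad f x = y" using qK y by (auto simp: x_def)
    let ?H = "hessian f x"
    have low: "\<alpha> * (norm v)\<^sup>2 \<le> v \<bullet> (?H *v v)" for v
      using lower x y by simp
    obtain A where A: "A ** ?H = mat 1" "?H ** A = mat 1"
      using invertible_if_positive_definite[OF \<open>\<alpha> > 0\<close> low] by (auto simp: invertible_def)
    \<comment> \<open>Differentiability of the inverse needs an interior point of the image
      \<open>cball 0 \<theta>\<close>; \<open>norm l < \<theta>\<close> keeps \<open>y\<close>
      interior up to \<open>t = 1\<close>.\<close>
    have "(q has_derivative (*v) A) (at (grad f x))"
    proof (rule has_derivative_inverse[OF \<open>compact K\<close> x(1) _ _ _ C2_has_derivative_grad[OF C2]])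
      show "grad f x \<in> interior (grad f ` K)"
        using hom y x by (simp add: homeomorphism_def)
      show "(*v) A \<circ> (*v) ?H = id"
        using A by (auto simp: matrix_vector_mul_assoc)
    qed (use hom in \<open>auto simp: homeomorphism_def matrix_vector_mul_bounded_linear\<close>)
    then have q: "(q has_derivative (*v) A) (at y)" by (simp add: x)
    have "((\<lambda>t. t *\<^sub>R - l) has_vector_derivative - l) (at t)"
      by (auto intro!: derivative_eq_intros)
    then have "((\<lambda>t. q (t *\<^sub>R - l)) has_vector_derivative A *v - l) (at t)"
      using vector_derivative_diff_chain_within[of "\<lambda>t. t *\<^sub>R - l" "- l" t UNIV q "(*v) A"]
        q[unfolded y_def] has_derivative_at_withinI by (fastforce simp: o_def)
    from has_real_derivative_compose_GDERIV[OF f this]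
    have "(\<phi> has_real_derivative (A *v - l) \<bullet> y - 2 * t * ((norm l)\<^sup>2 / (2 * \<alpha>))) (at t)"
      unfolding \<phi>_def using x
      using \<open>\<alpha> > 0\<close> by (auto intro!: derivative_eq_intros simp: x_def y_def)
    moreover have "(A *v - l) \<bullet> y \<le> t * ((norm l)\<^sup>2 / \<alpha>)"
    proof -
      \<comment> \<open>\<open>v\<close> is the velocity of the curve. From \<open>\<alpha>
        \<parallel>v\<parallel>^2 \<le> v \<bullet> - l \<le> \<parallel>v\<parallel>
        \<parallel>l\<parallel>\<close> follows \<open>\<parallel>v\<parallel> \<le>
        \<parallel>l\<parallel> / \<alpha>\<close>, which re-enters the second inequality.\<close>
      define v where "v = A *v - l"
      have Hv: "?H *v v = - l" using A by (simp add: v_def matrix_vector_mul_assoc)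
      have vl: "v \<bullet> - l \<le> norm v * norm l"
        using norm_cauchy_schwarz[of v "- l"] by simp
      then have "norm v * (\<alpha> * norm v) \<le> norm v * norm l"
        using low[of v] by (simp add: Hv power2_eq_square mult_ac)
      then have "\<alpha> * norm v \<le> norm l"
        by (cases "v = 0") (auto simp: mult_le_cancel_left)
      then have "norm v \<le> norm l / \<alpha>"
        using \<open>\<alpha> > 0\<close> by (simp add: field_simps)
      then have "norm v * norm l \<le> norm l / \<alpha> * norm l" by (rule mult_right_mono) simp
      then have "v \<bullet> - l \<le> (norm l)\<^sup>2 / \<alpha>"
        using vl by (simp add: power2_eq_square)
      then have "t * (v \<bullet> - l) \<le> t * ((norm l)\<^sup>2 / \<alpha>)" using t by (intro mult_left_mono)
      then show ?thesis by (simp add: y_def v_def)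
    qed
    ultimately show "\<exists>z. (\<phi> has_real_derivative z) (at t) \<and> z \<le> 0" by force
  qed simp
  then show ?thesis by (simp add: \<phi>_def)
qed

section \<open>Critical points of the tilted function\<close>

text \<open>\<open>Theta_bounded\<close> supplies the compactness behind the covering argument. It
  excludes cases such as \<open>f' = arctan\<close> on the line with \<open>\<theta> = 2\<close>:
  there \<open>Theta f \<theta> 0\<close> is the whole line, and for \<open>l = 1.9\<close> the
  tilted function has no critical point.\<close>

theorem theorem5p1:
  fixes f :: "real ^ 'n \<Rightarrow> real" and L \<theta> :: real and xs l :: "real ^ 'n"
  assumes C2: "C2 f"
    and Lipschitz: "L-lipschitz_on UNIV (grad f)"
    and theta_pos: "\<theta> > 0"
    and theta_small: "\<And>x. critical_point f x \<Longrightarrow> x \<in> Lambda_plus f \<Longrightarrow> Theta f \<theta> x \<subseteq> Lambda_plus f"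
    and xs_crit: "critical_point f xs"
    and xs_Lambda: "xs \<in> Lambda_plus f"
    and Theta_bounded: "bounded (Theta f \<theta> xs)"
    and l_small: "norm l < \<theta>"
  shows "\<exists>xl. xl \<in> Theta f \<theta> xs \<and> critical_point (\<lambda>x. f x + l \<bullet> x) xl \<and>
    (\<forall>y. y \<in> Theta f \<theta> xs \<and> critical_point (\<lambda>x. f x + l \<bullet> x) y \<longrightarrow> y = xl) \<and>
    nondegenerate_min (\<lambda>x. f x + l \<bullet> x) xl \<and>
    (\<forall>\<alpha>. strongly_convex_on \<alpha> (Theta f \<theta> xs) f \<longrightarrow> f xl - f xs \<le> \<theta>\<^sup>2 / (2 * \<alpha>))"
proof -
  define K where "K = Theta f \<theta> xs"
  define fl where "fl x = f x + l \<bullet> x" for x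
  have f: "GDERIV f y :> grad f y" for y
    using C2 differentiable_imp_GDERIV_grad by (auto simp: C2_def)
  have fl: "GDERIV fl y :> grad f y + l" for y
    unfolding fl_def using f[of y]
    by (intro GDERIV_add) (auto simp: gderiv_def inner_commute[of l] intro!: derivative_eq_intros)
  then have grad_fl: "grad fl = (\<lambda>y. grad f y + l)" using grad_eqI by blast
  have Dgrad_fl: "((\<lambda>y. grad f y + l) has_derivative (*v) (hessian f x)) (at x)" for x
    by (rule has_derivative_add_const) (rule C2_has_derivative_grad[OF C2])
  have hessian_fl: "hessian fl x = hessian f x" for x
    unfolding hessian_def[of fl] jacobian_def grad_fl
    by (simp flip: frechet_derivative_at[OF Dgrad_fl[of x]])
  have crit_fl: "critical_point fl x \<longleftrightarrow> grad f x = - l" for x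
    using fl[of x] grad_eqI[of fl x 0] by (auto simp: critical_point_def grad_fl add_eq_0_iff2)
  have grad_xs: "grad f xs = 0" using xs_crit grad_eqI by (auto simp: critical_point_def)
  have posdef: "\<exists>m>0. \<forall>v. m * (norm v)\<^sup>2 \<le> v \<bullet> (hessian f x *v v)" if "x \<in> K" for x
  proof -
    have "lambda_min (hessian f x) > 0"
      using theta_small[OF xs_crit xs_Lambda] that by (auto simp: K_def Lambda_plus_def)
    moreover have "u \<bullet> (hessian f x *v v) = v \<bullet> (hessian f x *v u)" for u v
      by (rule gradient_derivative_symmetric[OF f C2_has_derivative_grad[OF C2]])
    ultimately show ?thesis using positive_definite_if_lambda_min_pos by metis
  qed
  then have inv: "invertible (hessian f x)" if "x \<in> K" for x
    using that invertible_if_positive_definite by metis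
  obtain q where hom: "homeomorphism K (cball 0 \<theta>) (grad f) q"
    using grad_homeomorphism_Theta[OF C2 Theta_bounded] inv grad_xs theta_pos unfolding K_def by auto
  have "xs \<in> K" using grad_xs theta_pos by (simp add: K_def Theta_def L_set_def)
  \<comment> \<open>This identifies the start of the curve \<open>q (- t l)\<close> with
    \<open>xs\<close>.\<close>
  then have q0: "q 0 = xs" using hom grad_xs by (metis homeomorphism_apply1)
  define xl where "xl = q (- l)"
  have xl: "xl \<in> K" "grad f xl = - l" using hom l_small by (auto simp: xl_def homeomorphism_def)
  obtain m where m: "m > 0" "\<And>v. m * (norm v)\<^sup>2 \<le> v \<bullet> (hessian f xl *v v)" using posdef xl by blast
  have "nondegenerate_min fl xl"
    using local_min_of_gradient_derivative_positive[OF fl Dgrad_fl _ m(2,1)] xl inv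
    by (simp add: nondegenerate_min_def hessian_fl)
  moreover have "y = xl" if "y \<in> K" "grad f y = - l" for y
    using hom that by (metis homeomorphism_apply1 xl_def)
  moreover have "f xl - f xs \<le> \<theta>\<^sup>2 / (2 * \<alpha>)" if "strongly_convex_on \<alpha> K f" for \<alpha>
  proof -
    have "f xl - f xs \<le> (norm l)\<^sup>2 / (2 * \<alpha>)"
      using strongly_convex_critical_value_bound[OF C2 _ _ l_small] hom that
      unfolding K_def xl_def q0[symmetric] by blast
    also have "\<dots> \<le> \<theta>\<^sup>2 / (2 * \<alpha>)"
      using l_small that by (intro divide_right_mono power_mono) (auto simp: strongly_convex_on_def)
    finally show ?thesis .
  qed
  ultimately show ?thesis
    using xl crit_fl unfolding fl_def K_def by blast
qed

end
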